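(* Let \(\alpha=(\alpha_{0},\ldots,\alpha_{n})\) be a nonempty sequence of ordinals with \(\alpha_{i}<\alpha_{i+1}\) for \(0\leq i<n\). Then the class \(\epsilon\in H^{n}(X(\alpha)^{-};\mathbf{F}_{2})\) is nonzero.
   Context: \(X(\alpha)=(\aleph_{\alpha_{0}})^{+}\times\dotsb\times(\aleph_{\alpha_{n}})^{+}\), where \((\mathord{-})^{+}\) is the one-point compactification of a discrete space, and \(X(\alpha)^{-}\) is \(X(\alpha)\) minus its point at infinity. Let \(U_{i}\subset X(\alpha)^{-}\) be the subset of points whose \(i\)th coordinate is finite (not at infinity); the \(\mathbf{F}_{2}\)-cohomology of \(X(\alpha)^{-}\) is computed by the oriented Čech complex of this cover, so an \(n\)-cocycle is a function \(f\colon\aleph_{\alpha_{0}}\times\dotsb\times\aleph_{\alpha_{n}}\to\mathbf{F}_{2}\), and it is a coboundary iff \(f=f_{0}+\dotsb+f_{n}\) with each \(f_{i}\) constant outside a finite set in the \(i\)th coordinate when the other coordinates are fixed. Fix decompositions \(\aleph_{\alpha_{i}}=E_{i}\amalg F_{i}\) with \(|E_{i}|=|F_{i}|\), and let \(e(x_{0},\ldots,x_{n})=1\) if \(x_{i}\in E_{i}\) for all \(i\) and \(0\) otherwise. Then \(\epsilon\) is the class of the \(n\)-cocycle \(e\). *)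

theory Defs
  imports
    "HOL-Analysis.Analysis"
    "HOL-Algebra.Coset"
    "HOL-Library.Z2"
begin

unbundle cardinal_syntax

text \<open>
  Sheaf cohomology of a topological space \<open>X\<close> with coefficients in the constant sheaf of the
  two-element field, computed by the Godement resolution.

  Let \<open>T\<close> be the Godement functor, which sends a sheaf to the product of its stalks. The
  Godement resolution of the constant sheaf has the global sections of \<open>T\<^sup>n\<^sup>+\<^sup>1\<close> in degree \<open>n\<close>:
  a section is a family over \<open>x0\<close> in \<open>X\<close> of germs at \<open>x0\<close> of families over \<open>x1\<close> of germs at \<open>x1\<close>
  of (and so on) of elements of the field. Every such section is represented by a function on
  \<open>(n + 1)\<close>-tuples \<open>[x0, ..., xn]\<close>, and a function represents zero iff it vanishes for
  all \<open>x0\<close>, all \<open>x1\<close> near \<open>x0\<close>, all \<open>x2\<close> near \<open>x1\<close>, ..., all \<open>xn\<close> near \<open>x(n-1)\<close>.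
  The resolution consists of flasque sheaves, so no hypothesis on \<open>X\<close> is needed. We work with
  representatives; all signs are trivial in characteristic two.
\<close>

primrec successively_near :: "'a topology \<Rightarrow> nat \<Rightarrow> 'a \<Rightarrow> ('a list \<Rightarrow> bool) \<Rightarrow> bool" where
  "successively_near X 0 x P \<longleftrightarrow> P [x]"
| "successively_near X (Suc n) x P \<longleftrightarrow>
     eventually (\<lambda>y. successively_near X n y (\<lambda>ys. P (x # ys))) (nhdsin X x)"

definition null_cochains :: "'a topology \<Rightarrow> nat \<Rightarrow> ('a list \<Rightarrow> bit) set" where
  "null_cochains X n = {f. \<forall>x \<in> topspace X. successively_near X n x (\<lambda>xs. f xs = 0)}"

definition differential :: "('a list \<Rightarrow> bit) \<Rightarrow> 'a list \<Rightarrow> bit" where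
  "differential f xs = (\<Sum>i<length xs. f (take i xs @ drop (Suc i) xs))"

definition cocycles :: "'a topology \<Rightarrow> nat \<Rightarrow> ('a list \<Rightarrow> bit) set" where
  "cocycles X n = {f. differential f \<in> null_cochains X (Suc n)}"

text \<open>
  The case distinction is needed because the differential of a function of the empty tuple is
  the augmentation, which is not part of the complex.
\<close>

definition coboundaries :: "'a topology \<Rightarrow> nat \<Rightarrow> ('a list \<Rightarrow> bit) set" where
  "coboundaries X n =
     (if n = 0 then null_cochains X 0
      else {f. \<exists>g. (\<lambda>xs. f xs - differential g xs) \<in> null_cochains X n})"

definition cocycle_group :: "'a topology \<Rightarrow> nat \<Rightarrow> ('a list \<Rightarrow> bit) monoid" where
  "cocycle_group X n =
     \<lparr>carrier = cocycles X n, monoid.mult = (\<lambda>f g xs. f xs + g xs), one = (\<lambda>xs. 0)\<rparr>"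

definition cohomology_group :: "'a topology \<Rightarrow> nat \<Rightarrow> ('a list \<Rightarrow> bit) set monoid" where
  "cohomology_group X n = cocycle_group X n Mod coboundaries X n"

definition cohomology_class :: "'a topology \<Rightarrow> nat \<Rightarrow> ('a list \<Rightarrow> bit) \<Rightarrow> ('a list \<Rightarrow> bit) set" where
  "cohomology_class X n f = coboundaries X n #>\<^bsub>cocycle_group X n\<^esub> f"

text \<open>
  The comparison map from the oriented Cech complex of an open cover \<open>U i\<close> (\<open>i\<close> in \<open>I\<close>) to the
  Godement complex. An oriented Cech \<open>p\<close>-cochain with coefficients in the constant sheaf assigns
  to every \<open>J = {i0 < ... < ip}\<close> in \<open>I\<close> a locally constant function \<open>c J\<close> on the intersection
  of the \<open>U i\<close> with \<open>i\<close> in \<open>J\<close>. It is extended to arbitrary tuples of indices in the alternating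
  way, hence by zero on tuples with a repetition. Choosing for every point \<open>x\<close> an index
  \<open>l x\<close> with \<open>x\<close> in \<open>U (l x)\<close>, the cochain is sent to
  \<open>[x0, ..., xp] \<mapsto> c {l x0, ..., l xp} xp\<close>; if each point is near the previous one, then \<open>xp\<close>
  lies in the domain of this section. The induced map in cohomology does not depend on \<open>l\<close>.
\<close>

definition cech_to_godement ::
    "nat set \<Rightarrow> (nat \<Rightarrow> 'a set) \<Rightarrow> (nat set \<Rightarrow> 'a \<Rightarrow> bit) \<Rightarrow> 'a list \<Rightarrow> bit" where
  "cech_to_godement I U c xs =
     (let is = map (\<lambda>x. LEAST i. i \<in> I \<and> x \<in> U i) xs
      in if distinct is then c (set is) (last xs) else 0)"

text \<open>
  Ordinals are represented by well-orders, compared by \<open><o\<close>. A set \<open>A\<close> has cardinality aleph of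
  the ordinal \<open>r\<close> iff its cardinality is the \<open>r\<close>-th infinite cardinal (counting from zero), that
  is, \<open>A\<close> is infinite and the infinite cardinals below \<open>|A|\<close>, each represented by a subset of
  \<open>A\<close>, form a well-order of type \<open>r\<close>.
\<close>

definition has_card_aleph :: "'a set \<Rightarrow> 'b rel \<Rightarrow> bool" where
  "has_card_aleph A r \<longleftrightarrow>
     infinite A \<and>
     (\<exists>f. (\<forall>x \<in> Field r. f x \<subseteq> A \<and> infinite (f x) \<and> |f x| <o |A| ) \<and>
          (\<forall>x \<in> Field r. \<forall>y \<in> Field r. (x, y) \<in> r \<longleftrightarrow> |f x| \<le>o |f y| ) \<and>
          (\<forall>B \<subseteq> A. infinite B \<and> |B| <o |A| \<longrightarrow> (\<exists>x \<in> Field r. |B| =o |f x| )))"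

text \<open>
  The spaces. The sequence of sets \<open>A 0, ..., A n\<close> plays the role of the cardinals; the point at
  infinity of each factor is \<open>None\<close>.
\<close>

definition product_space :: "(nat \<Rightarrow> 'a set) \<Rightarrow> nat \<Rightarrow> (nat \<Rightarrow> 'a option) topology" where
  "product_space A n =
     product_topology (\<lambda>i. Alexandroff_compactification (discrete_topology (A i))) {..n}"

definition punctured_space :: "(nat \<Rightarrow> 'a set) \<Rightarrow> nat \<Rightarrow> (nat \<Rightarrow> 'a option) topology" where
  "punctured_space A n =
     subtopology (product_space A n) (topspace (product_space A n) - {\<lambda>i\<in>{..n}. None})"

definition finite_coordinate :: "(nat \<Rightarrow> 'a set) \<Rightarrow> nat \<Rightarrow> nat \<Rightarrow> (nat \<Rightarrow> 'a option) set" where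
  "finite_coordinate A n i = {x \<in> topspace (punctured_space A n). x i \<noteq> None}"

text \<open>
  The only component of a Cech \<open>n\<close>-cochain of this cover is the one for \<open>J = {..n}\<close>.
\<close>

definition e_cocycle :: "(nat \<Rightarrow> 'a set) \<Rightarrow> nat \<Rightarrow> nat set \<Rightarrow> (nat \<Rightarrow> 'a option) \<Rightarrow> bit" where
  "e_cocycle E n J x = (if J = {..n} \<and> (\<forall>i\<le>n. x i \<in> Some ` E i) then 1 else 0)"

definition epsilon_class ::
    "(nat \<Rightarrow> 'a set) \<Rightarrow> (nat \<Rightarrow> 'a set) \<Rightarrow> nat \<Rightarrow> ((nat \<Rightarrow> 'a option) list \<Rightarrow> bit) set" where
  "epsilon_class A E n =
     cohomology_class (punctured_space A n) n
       (cech_to_godement {..n} (finite_coordinate A n) (e_cocycle E n))"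

end

theory Submission
  imports Defs
begin

text \<open>
  A flag of \<open>{..n}\<close>, encoded as the list of its successively added elements, and a tuple \<open>p\<close> of
  finite coordinates determine the chain of points that agree with \<open>p\<close> on the members of the flag
  and are infinite elsewhere. Summing a differential \<open>dg\<close> over the chains of all flags cancels
  every face except the last, because omitting any other member leaves a chain that belongs to
  exactly two flags; the last face of a chain does not depend on one of the coordinates of \<open>p\<close>.
  The cocycle itself contributes \<open>e(p)\<close>, from the flag that adds the coordinates in decreasing
  order. So a coboundary would have to vanish when summed over the cube of all \<open>p\<close> with
  \<open>p i \<in> {a i, b i}\<close>, whereas for \<open>a i \<in> E i\<close> and \<open>b i \<in> F i\<close> the sum of \<open>e\<close> is \<open>1\<close>.

  The identities between cochains hold only along chains of successively near points, that is,
  when each \<open>p i\<close> avoids finite sets that depend on the other coordinates. Since the cardinals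
  increase strictly, \<open>a i\<close> and \<open>b i\<close> can be chosen for \<open>i = n, ..., 0\<close> in turn so as to avoid the
  finite sets attached to all possible values of the earlier coordinates.
\<close>

subsection \<open>Cardinal arithmetic\<close>

text \<open>If \<open>r <o s\<close>, an isomorphism \<open>f\<close> of \<open>r\<close> onto a
  proper initial segment of \<open>s\<close>, composed with \<open>h\<close>, gives a strictly
  increasing self-map \<open>k\<close> of \<open>s\<close>. It sends any \<open>b\<close> outside
  the segment below itself, whereas a strictly increasing self-map of a well-order moves no point
  down.\<close>

lemma not_ordLess_if_order_embedding:
  fixes r :: "'a rel" and s :: "'b rel"
  assumes "Well_order r" "Well_order s"
    and h: "\<And>x. x \<in> Field s \<Longrightarrow> h x \<in> Field r"
    and iff: "\<And>x y. x \<in> Field s \<Longrightarrow> y \<in> Field s \<Longrightarrow> (h x, h y) \<in> r \<longleftrightarrow> (x, y) \<in> s"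
  shows "\<not> r <o s"
proof
  assume "r <o s"
  then obtain f where f: "embed r s f" "\<not> bij_betw f (Field r) (Field s)"
    unfolding ordLess_def by (auto simp: embedS_def)
  have wr: "wo_rel r" and ws: "wo_rel s"
    using assms(1,2) by (auto simp: wo_rel_def)
  have fr: "compat r s f" "inj_on f (Field r)" "wo_rel.ofilter s (f ` Field r)"
    using f(1) embed_iff_compat_inj_on_ofilter[OF assms(1,2)] by blast+
  have "f ` Field r \<subset> Field s"
    using f embedS_iff[OF assms(1) f(1)] by (simp add: embedS_def)
  then obtain b where b: "b \<in> Field s" "b \<notin> f ` Field r" by blast
  have fF: "f x \<in> Field s" if "x \<in> Field r" for x
    using that \<open>f ` Field r \<subset> Field s\<close> by blast
  have antisym_r: "antisym r" and antisym_s: "antisym s" and trans_s: "trans s"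
    and refl_s: "refl_on (Field s) s" and wf_s: "wf (s - Id)"
    using assms(1,2) by (auto simp: order_on_defs)
  have inj_h: "x = y" if "x \<in> Field s" "y \<in> Field s" "h x = h y" for x y
  proof -
    have "(h x, h y) \<in> r" "(h y, h x) \<in> r"
      using that iff[of x x] refl_s by (auto simp: refl_on_def)
    then show ?thesis using iff that antisym_s by (meson antisymD)
  qed
  define k where "k x = f (h x)" for x
  have kF: "k x \<in> Field s" if "x \<in> Field s" for x
    using that h fF by (simp add: k_def)
  have k_strict: "(k x, k y) \<in> s - Id" if "(x, y) \<in> s - Id" for x y
  proof -
    have xy: "x \<in> Field s" "y \<in> Field s" "x \<noteq> y"
      using that by (auto simp: Field_def)
    then have "h x \<noteq> h y" using inj_h by blast
    then have "k x \<noteq> k y" using fr(2) h xy unfolding k_def by (meson inj_onD)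
    moreover have "(k x, k y) \<in> s"
      using fr(1) iff[of x y] xy that by (simp add: k_def compat_def)
    ultimately show ?thesis by simp
  qed
  \<comment> \<open>The image of \<open>f\<close> is closed downwards and contains
    \<open>k b\<close> but not \<open>b\<close>.\<close>
  have "(b, k b) \<notin> s"
  proof
    assume "(b, k b) \<in> s"
    moreover have "k b \<in> f ` Field r" using b h by (simp add: k_def)
    ultimately have "b \<in> f ` Field r"
      using fr(3) unfolding wo_rel.ofilter_def[OF ws] under_def by blast
    then show False using b by blast
  qed
  then have kb: "(k b, b) \<in> s - Id"
    using wo_rel.TOTALS[OF ws] kF[OF b(1)] b(1) refl_s by (auto simp: refl_on_def)
  \<comment> \<open>There is no least \<open>x\<close> with \<open>k x\<close> below
    \<open>x\<close>, because then \<open>k (k x)\<close> lies below \<open>k x\<close>.\<close>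
  have "\<not> (k x, x) \<in> s - Id" for x
    using wf_s by (induction x) (use k_strict in blast)
  then show False using kb by blast
qed

text \<open>If \<open>|B| \<le>o |A|\<close>, the infinite cardinals below \<open>|B|\<close> are
  also below \<open>|A|\<close>. Matching their indices embeds \<open>s\<close> into
  \<open>r\<close> as an order, which \<open>r <o s\<close> forbids.\<close>

lemma has_card_aleph_strict_mono:
  fixes A :: "'a set" and B :: "'b set" and r :: "'c rel" and s :: "'d rel"
  assumes "Well_order r" "r <o s" and A: "has_card_aleph A r" and B: "has_card_aleph B s"
  shows "|A| <o |B|"
proof (rule ccontr)
  assume "\<not> |A| <o |B|"
  then have BA: "|B| \<le>o |A|" 
    using ordLess_or_ordLeq[OF card_of_Well_order card_of_Well_order, of A B] by blast
  obtain f :: "'c \<Rightarrow> 'a set" where f0: "\<forall>x \<in> Field r. \<forall>y \<in> Field r. (x, y) \<in> r \<longleftrightarrow> |f x| \<le>o |f y|"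
      "\<forall>C \<subseteq> A. infinite C \<and> |C| <o |A| \<longrightarrow> (\<exists>x \<in> Field r. |C| =o |f x| )"
    using A unfolding has_card_aleph_def by (elim conjE exE) (rule that; assumption)
  have f: "(x, y) \<in> r \<longleftrightarrow> |f x| \<le>o |f y|" if "x \<in> Field r" "y \<in> Field r" for x y
    using f0(1)[rule_format, OF that] .
  have f_onto: "\<exists>x \<in> Field r. |C| =o |f x|" if "C \<subseteq> A" "infinite C" "|C| <o |A|" for C
    using f0(2)[rule_format, OF that(1) conjI[OF that(2,3)]] .
  obtain g :: "'d \<Rightarrow> 'b set" where g0: "\<forall>x \<in> Field s. g x \<subseteq> B \<and> infinite (g x) \<and> |g x| <o |B|"
      "\<forall>x \<in> Field s. \<forall>y \<in> Field s. (x, y) \<in> s \<longleftrightarrow> |g x| \<le>o |g y|"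
    using B unfolding has_card_aleph_def by (elim conjE exE) (rule that; assumption)
  have g_inf: "infinite (g x)" and g_less: "|g x| <o |B|" if "x \<in> Field s" for x
    using g0(1)[THEN bspec, OF that] by simp_all
  have g: "(x, y) \<in> s \<longleftrightarrow> |g x| \<le>o |g y|" if "x \<in> Field s" "y \<in> Field s" for x y
    using g0(2)[rule_format, OF that] .
  have "\<exists>y \<in> Field r. |g x| =o |f y|" if x: "x \<in> Field s" for x
  proof -
    have less: "|g x| <o |A|" using g_less[OF x] BA by (rule ordLess_ordLeq_trans)
    then have "|g x| \<le>o |A|" by (rule ordLess_imp_ordLeq)
    then obtain C where C: "C \<subseteq> A" "|g x| =o |C|"
      using internalize_card_of_ordLeq2[of "g x" A] by blast
    have "infinite C" using g_inf[OF x] card_of_ordIso_finite[OF C(2)] by simp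
    moreover have "|C| <o |A|" using ordIso_symmetric[OF C(2)] less by (rule ordIso_ordLess_trans)
    ultimately obtain y where "y \<in> Field r" "|C| =o |f y|" using f_onto[OF C(1)] by blast
    then show ?thesis using ordIso_transitive[OF C(2)] by blast
  qed
  then obtain h where "\<forall>x \<in> Field s. h x \<in> Field r \<and> |g x| =o |f (h x)|"
    using bchoice[of "Field s" "\<lambda>x y. y \<in> Field r \<and> |g x| =o |f y|"] by blast
  then have h: "h x \<in> Field r" "|g x| =o |f (h x)|" if "x \<in> Field s" for x
    using that by blast+
  have "(h x, h y) \<in> r \<longleftrightarrow> (x, y) \<in> s" if x: "x \<in> Field s" and y: "y \<in> Field s" for x y
  proof -
    have "|f (h x)| \<le>o |f (h y)| \<longleftrightarrow> |g x| \<le>o |g y|"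
    proof
      assume "|f (h x)| \<le>o |f (h y)|"
      with h(2)[OF x] have "|g x| \<le>o |f (h y)|" by (rule ordIso_ordLeq_trans)
      then show "|g x| \<le>o |g y|" using ordIso_symmetric[OF h(2)[OF y]] by (rule ordLeq_ordIso_trans)
    next
      assume "|g x| \<le>o |g y|"
      with ordIso_symmetric[OF h(2)[OF x]] have "|f (h x)| \<le>o |g y|" by (rule ordIso_ordLeq_trans)
      then show "|f (h x)| \<le>o |f (h y)|" using h(2)[OF y] by (rule ordLeq_ordIso_trans)
    qed
    then show ?thesis using f[OF h(1)[OF x] h(1)[OF y]] g[OF x y] by (simp only:)
  qed
  moreover have "Well_order s" using assms(2) by (simp add: ordLess_def)
  ultimately have "\<not> r <o s"
    using not_ordLess_if_order_embedding[of r s h] assms(1) h(1) by blast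
  then show False using assms(2) by blast
qed

lemma card_of_finite_ordLess_infinite:
  assumes "finite A" "infinite B"
  shows "|A| <o |B|"
  using assms by (intro finite_ordLess_infinite card_of_Well_order) (simp_all add: Field_card_of)

text \<open>Splitting off the last coordinate bounds the product over \<open>{..<Suc i}\<close> by a
  product with the infinite set \<open>A i\<close>, which absorbs the smaller factor. The induction
  starts from the empty product, a single function.\<close>

lemma card_of_PiE_initial_less:
  fixes A :: "nat \<Rightarrow> 'a set"
  assumes inf: "\<And>i. i \<le> n \<Longrightarrow> infinite (A i)"
    and less: "\<And>i. i < n \<Longrightarrow> |A i| <o |A (Suc i)|"
  shows "i \<le> n \<Longrightarrow> |PiE {..<i} A| <o |A i|"
proof (induction i)
  case 0
  then show ?case using inf[of 0] by (simp add: card_of_finite_ordLess_infinite)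
next
  case (Suc i)
  have "inj_on (\<lambda>q. (q(i := undefined), q i)) (PiE {..<Suc i} A)"
  proof (rule inj_onI)
    fix p q :: "nat \<Rightarrow> 'a"
    assume "(p(i := undefined), p i) = (q(i := undefined), q i)"
    then have "(p(i := undefined))(i := p i) = (q(i := undefined))(i := q i)"
      by (simp only: prod.inject)
    then show "p = q" by simp
  qed
  moreover have "(\<lambda>q. (q(i := undefined), q i)) ` PiE {..<Suc i} A \<subseteq> PiE {..<i} A \<times> A i"
  proof (rule image_subsetI)
    fix q assume q: "q \<in> PiE {..<Suc i} A"
    then have "q(i := undefined) \<in> PiE {..<i} A" by (auto simp: PiE_iff extensional_def)
    then show "(q(i := undefined), q i) \<in> PiE {..<i} A \<times> A i" using PiE_mem[OF q, of i] by simp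
  qed
  ultimately have "|PiE {..<Suc i} A| \<le>o |PiE {..<i} A \<times> A i|"
    using card_of_ordLeq by blast
  also have "|PiE {..<i} A \<times> A i| =o |A i|"
  proof (rule card_of_Times_infinite_simps)
    show "infinite (A i)" using inf Suc.prems by simp
    have "A j \<noteq> {}" if "j < i" for j using inf[of j] that Suc.prems by auto
    then show "PiE {..<i} A \<noteq> {}" by (simp add: PiE_eq_empty_iff)
    show "|PiE {..<i} A| \<le>o |A i|" using Suc ordLess_imp_ordLeq by auto
  qed
  also have "|A i| <o |A (Suc i)|" using less Suc.prems by simp
  finally show ?case .
qed

lemma card_of_UNION_finite_less:
  assumes "|I| <o |B|" "infinite B" and fin: "\<And>i. i \<in> I \<Longrightarrow> finite (S i)"
  shows "|\<Union>i\<in>I. S i| <o |B|"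
proof (cases "finite I")
  case True
  then show ?thesis using assms by (intro card_of_finite_ordLess_infinite) auto
next
  case False
  then have "|\<Union>i\<in>I. S i| \<le>o |I|"
    using fin card_of_finite_ordLess_infinite
    by (intro card_of_UNION_ordLeq_infinite) (blast intro: ordLess_imp_ordLeq card_of_mono1)+
  then show ?thesis using assms(1) by (rule ordLeq_ordLess_trans)
qed

section \<open>Choosing values outside small exceptional sets\<close>

text \<open>The exceptional values of \<open>p i\<close> may depend on all other coordinates. The
  top pair is chosen first and avoids the exceptional sets of all lower tuples at once, since there
  are fewer such tuples than elements of \<open>E m\<close> or \<open>F m\<close>. The lower pairs
  then have to cope with only two values of the top coordinate.\<close>

lemma ex_generic_pairs:
  fixes A E F :: "nat \<Rightarrow> 'a set" and bad :: "(nat \<Rightarrow> 'a) \<Rightarrow> nat \<Rightarrow> bool"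
  assumes "\<And>i. i < m \<Longrightarrow> E i \<subseteq> A i" "\<And>i. i < m \<Longrightarrow> F i \<subseteq> A i"
    and "\<And>i. i < m \<Longrightarrow> infinite (E i)" "\<And>i. i < m \<Longrightarrow> infinite (F i)"
    and "\<And>i. i < m \<Longrightarrow> |PiE {..<i} A| <o |E i|" "\<And>i. i < m \<Longrightarrow> |PiE {..<i} A| <o |F i|"
    and "\<And>i q. i < m \<Longrightarrow> q \<in> PiE {..<m} A \<Longrightarrow> finite {x \<in> A i. bad (q(i := x)) i}"
  shows "\<exists>a b. (\<forall>i<m. a i \<in> E i \<and> b i \<in> F i) \<and>
           (\<forall>p \<in> PiE {..<m} (\<lambda>i. {a i, b i}). \<forall>i<m. \<not> bad p i)"
  using assms
proof (induction m arbitrary: bad)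
  case 0
  then show ?case by simp
next
  case (Suc m)
  define U where "U = (\<Union>q \<in> PiE {..<m} A. {x \<in> A m. bad (q(m := x)) m})"
  have finU: "finite {x \<in> A m. bad (q(m := x)) m}" if q: "q \<in> PiE {..<m} A" for q
  proof -
    \<comment> \<open>The hypothesis concerns tuples that include a top coordinate; any
      \<open>y\<close> serves, as it is overwritten by \<open>x\<close>.\<close>
    obtain y where "y \<in> A m" using Suc.prems(1,3)[of m] by fastforce
    then have "q(m := y) \<in> PiE {..<Suc m} A"
      using q by (auto simp: PiE_iff extensional_def less_Suc_eq)
    then show ?thesis using Suc.prems(7)[of m "q(m := y)"] by (simp del: fun_upd_apply)
  qed
  have pick: "\<exists>x \<in> G. x \<notin> U" if "|PiE {..<m} A| <o |G|" "infinite G" for G :: "'a set"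
  proof (rule ccontr)
    assume "\<not> ?thesis"
    then have "|G| \<le>o |U|" by (intro card_of_mono1) blast
    moreover have "|U| <o |G|"
      unfolding U_def using that finU by (intro card_of_UNION_finite_less)
    ultimately show False using not_ordLess_ordLeq by blast
  qed
  obtain am bm where am: "am \<in> E m" "am \<notin> U" and bm: "bm \<in> F m" "bm \<notin> U"
    using pick[of "E m"] pick[of "F m"] Suc.prems(3-6)[of m] by blast
  have ab_A: "am \<in> A m" "bm \<in> A m" using am bm Suc.prems(1,2)[of m] by auto
  \<comment> \<open>The induction hypothesis is applied to being bad for at least one of the two top
    values; the exceptional sets are then unions of two finite sets.\<close>
  have "\<exists>a b. (\<forall>i<m. a i \<in> E i \<and> b i \<in> F i) \<and>
      (\<forall>p \<in> PiE {..<m} (\<lambda>i. {a i, b i}). \<forall>i<m. \<not> (bad (p(m := am)) i \<or> bad (p(m := bm)) i))"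
  proof (rule Suc.IH)
    fix i q assume i: "i < m" and q: "q \<in> PiE {..<m} A"
    have "finite {x \<in> A i. bad ((q(m := c))(i := x)) i}" if "c \<in> A m" for c
    proof (rule Suc.prems(7))
      show "q(m := c) \<in> PiE {..<Suc m} A"
        using q that by (auto simp: PiE_iff extensional_def less_Suc_eq)
    qed (use i in simp)
    from finite_UnI[OF this[OF ab_A(1)] this[OF ab_A(2)]]
    show "finite {x \<in> A i. bad ((q(i := x))(m := am)) i \<or> bad ((q(i := x))(m := bm)) i}"
      by (rule rev_finite_subset) (use i in \<open>auto simp: fun_upd_twist\<close>)
  qed (use Suc.prems in simp_all)
  then obtain a b where ab: "\<And>i. i < m \<Longrightarrow> a i \<in> E i \<and> b i \<in> F i"
    and good: "\<And>p i. p \<in> PiE {..<m} (\<lambda>i. {a i, b i}) \<Longrightarrow> i < m \<Longrightarrow>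
                 \<not> bad (p(m := am)) i \<and> \<not> bad (p(m := bm)) i"
    by blast
  have "\<not> bad p i"
    if p: "p \<in> PiE {..<Suc m} (\<lambda>i. {(a(m := am)) i, (b(m := bm)) i})" and i: "i < Suc m" for p i
  proof -
    define q where "q = p(m := undefined)"
    have q: "q \<in> PiE {..<m} (\<lambda>i. {a i, b i})"
      unfolding PiE_iff
    proof (intro conjI ballI)
      fix j assume "j \<in> {..<m}"
      then show "q j \<in> {a j, b j}"
        using PiE_mem[OF p, of j] by (auto simp: q_def)
    qed (use p in \<open>auto simp: q_def PiE_iff extensional_def\<close>)
    have pm: "p m = am \<or> p m = bm" using PiE_mem[OF p, of m] by auto
    have p_eq: "p = q(m := p m)" by (simp add: q_def)
    have "q \<in> PiE {..<m} A"
    proof (rule subsetD[OF PiE_mono q])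
      show "{a i, b i} \<subseteq> A i" if "i \<in> {..<m}" for i
        using ab[of i] Suc.prems(1,2)[of i] that by auto
    qed
    show ?thesis
    proof (cases "i = m")
      case True
      have "p m \<notin> U" "p m \<in> A m" using pm am bm ab_A by auto
      then have "\<not> bad (q(m := p m)) m" using \<open>q \<in> PiE {..<m} A\<close> by (auto simp: U_def)
      then show ?thesis using True p_eq by simp
    next
      case False
      then show ?thesis using good[OF q, of i] i pm p_eq by (metis less_antisym)
    qed
  qed
  moreover have "(a(m := am)) i \<in> E i \<and> (b(m := bm)) i \<in> F i" if "i < Suc m" for i
    using ab that am bm by (auto simp: less_Suc_eq)
  ultimately show ?case by blast
qed

subsection \<open>Near points and chains of points\<close>

lemma in_topspace_punctured_space_iff:
  "x \<in> topspace (punctured_space A n) \<longleftrightarrow>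
     x \<in> extensional {..n} \<and> (\<forall>i\<le>n. x i \<in> insert None (Some ` A i)) \<and> (\<exists>i\<le>n. x i \<noteq> None)"
proof -
  have "x = (\<lambda>i\<in>{..n}. None) \<longleftrightarrow> (\<forall>i\<le>n. x i = None)" if "x \<in> extensional {..n}"
  proof
    assume "\<forall>i\<le>n. x i = None"
    then show "x = (\<lambda>i\<in>{..n}. None)"
      using that by (intro extensionalityI[of _ "{..n}"]) simp_all
  next
    assume "x = (\<lambda>i\<in>{..n}. None)"
    then show "\<forall>i\<le>n. x i = None" by simp
  qed
  moreover have "x \<in> topspace (punctured_space A n) \<longleftrightarrow>
      (x \<in> extensional {..n} \<and> (\<forall>i\<le>n. x i \<in> insert None (Some ` A i))) \<and> x \<noteq> (\<lambda>i\<in>{..n}. None)"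
    by (auto simp: punctured_space_def product_space_def PiE_iff)
  ultimately show ?thesis
    by (cases "x \<in> extensional {..n}") simp_all
qed

text \<open>Finite points of the compactified factors are isolated, so the box with side
  \<open>{x i}\<close> at each finite coordinate and full side elsewhere is open.\<close>

lemma eventually_same_finite_coordinates:
  assumes x: "x \<in> topspace (punctured_space A n)"
  shows "eventually (\<lambda>y. y \<in> topspace (punctured_space A n) \<and> (\<forall>i\<le>n. x i \<noteq> None \<longrightarrow> y i = x i))
           (nhdsin (punctured_space A n) x)"
proof -
  define T where "T = PiE {..n} (\<lambda>i. if x i = None then insert None (Some ` A i) else {x i})"
  have xi: "x i \<in> insert None (Some ` A i)" if "i \<le> n" for i
    using x that unfolding in_topspace_punctured_space_iff by blast
  have "openin (Alexandroff_compactification (discrete_topology (A i)))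
      (if x i = None then insert None (Some ` A i) else {x i})" if i: "i \<le> n" for i
  proof (cases "x i")
    case None
    have "openin (Alexandroff_compactification (discrete_topology (A i)))
        (topspace (Alexandroff_compactification (discrete_topology (A i))))"
      by (rule openin_topspace)
    then show ?thesis using None by simp
  next
    case (Some a)
    then have "openin (Alexandroff_compactification (discrete_topology (A i))) (Some ` {a})"
      using xi[OF i] by (simp del: image_insert) auto
    then show ?thesis using Some by simp
  qed
  then have "openin (product_space A n) T"
    unfolding T_def product_space_def openin_PiE_gen by (intro disjI2) simp
  then have "openin (punctured_space A n) (T \<inter> (topspace (product_space A n) - {\<lambda>i\<in>{..n}. None}))"
    unfolding punctured_space_def by (rule openin_subtopology_Int)
  then have "openin (punctured_space A n) (T \<inter> topspace (punctured_space A n))"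
    by (simp add: punctured_space_def Int_absorb1)
  moreover have "x \<in> T"
    using x xi by (auto simp: T_def PiE_iff in_topspace_punctured_space_iff)
  moreover have "y i = x i" if "y \<in> T" "i \<le> n" "x i \<noteq> None" for y i
    using PiE_mem[OF that(1)[unfolded T_def], of i] that(2,3) by simp
  ultimately show ?thesis
    unfolding eventually_nhdsin using x by blast
qed

text \<open>The line \<open>t \<mapsto> x(j := t)\<close> is continuous on the compactified factor
  and passes through \<open>x\<close> at infinity. A neighbourhood of \<open>x\<close> therefore
  contains all of it except the points over a compact, hence finite, subset of the discrete set
  \<open>A j\<close>.\<close>

lemma finite_exceptional_coordinate:
  assumes x: "x \<in> topspace (punctured_space A n)" and j: "j \<le> n" "x j = None"
    and Q: "eventually Q (nhdsin (punctured_space A n) x)"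
  shows "finite {a \<in> A j. \<not> Q (x(j := Some a))}"
proof -
  let ?C = "Alexandroff_compactification (discrete_topology (A j))"
  obtain S where "openin (punctured_space A n) S" "x \<in> S" and S: "\<And>y. y \<in> S \<Longrightarrow> Q y"
    using Q x unfolding eventually_nhdsin by blast
  then obtain T where T: "openin (product_space A n) T" "x \<in> T"
      and ST: "\<And>y. y \<in> T \<Longrightarrow> y \<in> topspace (punctured_space A n) \<Longrightarrow> y \<in> S"
    unfolding punctured_space_def openin_subtopology by auto
  have "continuous_map ?C (product_space A n) (\<lambda>t. x(j := t))"
    unfolding product_space_def continuous_map_componentwise
  proof (intro conjI ballI image_subsetI)
    show "x(j := t) \<in> extensional {..n}" for t
      using x j by (auto simp: in_topspace_punctured_space_iff extensional_def)
    fix i assume i: "i \<in> {..n}"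
    show "continuous_map ?C (Alexandroff_compactification (discrete_topology (A i)))
        (\<lambda>t. (x(j := t)) i)"
    proof (cases "i = j")
      case False
      moreover have "x i \<in> topspace (Alexandroff_compactification (discrete_topology (A i)))"
        using x i unfolding in_topspace_punctured_space_iff by simp
      ultimately show ?thesis by simp
    qed simp
  qed
  then have open_pre: "openin ?C {t \<in> topspace ?C. x(j := t) \<in> T}"
    using T(1) by (rule openin_continuous_map_preimage)
  have None: "None \<in> {t \<in> topspace ?C. x(j := t) \<in> T}"
    using T(2) j by simp (metis fun_upd_triv)
  then obtain K where K: "compactin (discrete_topology (A j)) K"
      "{t \<in> topspace ?C. x(j := t) \<in> T} = insert None (Some ` (A j - K))"
    using open_pre unfolding openin_Alexandroff_compactification by auto
  have "{a \<in> A j. \<not> Q (x(j := Some a))} \<subseteq> K"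
  proof clarify
    fix a assume a: "a \<in> A j" "\<not> Q (x(j := Some a))"
    show "a \<in> K"
    proof (rule ccontr)
      assume "a \<notin> K"
      then have "Some a \<in> {t \<in> topspace ?C. x(j := t) \<in> T}" using K(2) a by blast
      then have "x(j := Some a) \<in> T" by blast
      moreover have "x(j := Some a) \<in> topspace (punctured_space A n)"
        using x j a by (auto simp: in_topspace_punctured_space_iff extensional_def)
      ultimately show False using S ST a by blast
    qed
  qed
  moreover have "finite K" using K(1) by (simp add: compactin_discrete_topology)
  ultimately show ?thesis by (rule finite_subset)
qed

text \<open>Reduces iterated neighbourhood conditions to chains, for any relation \<open>R\<close>
  that holds between each point and all points near it.\<close>

lemma successively_nearI:
  assumes near: "\<And>x. x \<in> topspace X \<Longrightarrow> eventually (\<lambda>y. y \<in> topspace X \<and> R x y) (nhdsin X x)"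
    and "x \<in> topspace X"
    and "\<And>ys. length ys = m \<Longrightarrow> set ys \<subseteq> topspace X \<Longrightarrow> successively R (x # ys) \<Longrightarrow> P (x # ys)"
  shows "successively_near X m x P"
  using assms(2,3)
proof (induction m arbitrary: x P)
  case 0
  show ?case using "0.prems"(2)[of "[]"] by simp
next
  case (Suc m)
  have "successively_near X m y (\<lambda>ys. P (x # ys))" if "y \<in> topspace X \<and> R x y" for y
    using that by (intro Suc.IH) (auto intro!: Suc.prems(2))
  then show ?case
    using near[OF Suc.prems(1)] by (simp add: eventually_mono)
qed

section \<open>Chains of points attached to flags\<close>

definition flag_point :: "nat \<Rightarrow> (nat \<Rightarrow> 'a) \<Rightarrow> nat set \<Rightarrow> nat \<Rightarrow> 'a option" where
  "flag_point n p I = (\<lambda>i\<in>{..n}. if i \<in> I then Some (p i) else None)"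

text \<open>Because of \<open>Suc k\<close> the chain starts with one finite coordinate; the empty
  initial segment would give the removed point at infinity.\<close>

definition flag_points :: "nat \<Rightarrow> (nat \<Rightarrow> 'a) \<Rightarrow> nat list \<Rightarrow> (nat \<Rightarrow> 'a option) list" where
  "flag_points n p \<sigma> = map (\<lambda>k. flag_point n p (set (take (Suc k) \<sigma>))) [0..<length \<sigma>]"

lemma length_flag_points [simp]: "length (flag_points n p \<sigma>) = length \<sigma>"
  by (simp add: flag_points_def)

lemma nth_flag_points:
  "k < length \<sigma> \<Longrightarrow> flag_points n p \<sigma> ! k = flag_point n p (set (take (Suc k) \<sigma>))"
  by (simp add: flag_points_def)

lemma flag_points_Nil [simp]: "flag_points n p [] = []"
  by (simp add: flag_points_def)

lemma flag_points_snoc: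
  "flag_points n p (\<sigma> @ [i]) = flag_points n p \<sigma> @ [flag_point n p (insert i (set \<sigma>))]"
  by (simp add: flag_points_def)

lemma flag_point_cong: "(\<And>i. i \<in> I \<Longrightarrow> p i = q i) \<Longrightarrow> flag_point n p I = flag_point n q I"
  by (auto simp: flag_point_def restrict_def)

lemma flag_points_cong:
  "(\<And>i. i \<in> set \<sigma> \<Longrightarrow> p i = q i) \<Longrightarrow> flag_points n p \<sigma> = flag_points n q \<sigma>"
  by (induction \<sigma> rule: rev_induct) (auto simp: flag_points_snoc intro!: flag_point_cong)

lemma flag_point_upd_insert:
  "i \<le> n \<Longrightarrow> i \<notin> I \<Longrightarrow> flag_point n (p(i := x)) (insert i I) = (flag_point n p I)(i := Some x)"
  by (auto simp: flag_point_def restrict_def)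

lemma flag_point_in_topspace:
  assumes "I \<subseteq> {..n}" "I \<noteq> {}" "\<And>i. i \<in> I \<Longrightarrow> p i \<in> A i"
  shows "flag_point n p I \<in> topspace (punctured_space A n)"
proof -
  have "\<exists>i\<le>n. flag_point n p I i \<noteq> None"
    using assms(1,2) by (auto simp: flag_point_def)
  then show ?thesis
    using assms(3) by (simp add: in_topspace_punctured_space_iff) (auto simp: flag_point_def)
qed

lemma last_flag_points: "\<sigma> \<noteq> [] \<Longrightarrow> last (flag_points n p \<sigma>) = flag_point n p (set \<sigma>)"
  by (cases \<sigma> rule: rev_cases) (simp_all add: flag_points_snoc)

text \<open>Each new point of a chain changes one coordinate of the preceding point from infinity to
  \<open>p i\<close>, so nearness excludes only finitely many values of \<open>p i\<close>. Generic
  pairs avoid these for all flags and all vertices of the cube.\<close>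

lemma ex_generic_flags:
  fixes A E F :: "nat \<Rightarrow> 'a set"
  assumes sub: "\<And>i. i \<le> n \<Longrightarrow> E i \<subseteq> A i" "\<And>i. i \<le> n \<Longrightarrow> F i \<subseteq> A i"
    and inf: "\<And>i. i \<le> n \<Longrightarrow> infinite (E i)" "\<And>i. i \<le> n \<Longrightarrow> infinite (F i)"
    and less: "\<And>i. i \<le> n \<Longrightarrow> |PiE {..<i} A| <o |E i|" "\<And>i. i \<le> n \<Longrightarrow> |PiE {..<i} A| <o |F i|"
    and P: "\<And>x. x \<in> topspace (punctured_space A n) \<Longrightarrow> successively_near (punctured_space A n) n x P"
  shows "\<exists>a b. (\<forall>i\<le>n. a i \<in> E i \<and> b i \<in> F i) \<and>
           (\<forall>p \<in> PiE {..n} (\<lambda>i. {a i, b i}). \<forall>\<sigma>. distinct \<sigma> \<and> set \<sigma> = {..n} \<longrightarrow> P (flag_points n p \<sigma>))"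
proof -
  let ?X = "punctured_space A n"
  \<comment> \<open>\<open>R xs\<close> says that the successively near continuations of
    \<open>xs\<close> to length \<open>Suc n\<close> satisfy \<open>P\<close>. The recursion starts
    at the last entry of \<open>xs\<close>, so only the entries before it are prefixed.\<close>
  define R where "R xs \<longleftrightarrow> successively_near ?X (Suc n - length xs) (last xs) (\<lambda>ys. P (butlast xs @ ys))"
    for xs
  have R_step: "eventually (\<lambda>y. R (xs @ [y])) (nhdsin ?X (last xs))"
    if "R xs" "xs \<noteq> []" "length xs \<le> n" for xs
  proof -
    have "butlast xs @ last xs # ys = xs @ ys" for ys
      using that(2) by (cases xs rule: rev_cases) auto
    moreover have "eventually (\<lambda>y. successively_near ?X (n - length xs) y
        (\<lambda>ys. P (butlast xs @ last xs # ys))) (nhdsin ?X (last xs))"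
      using that(1) unfolding R_def Suc_diff_le[OF that(3)] successively_near.simps .
    ultimately show ?thesis
      by (simp only: R_def length_append_singleton diff_Suc_Suc last_snoc butlast_snoc)
  qed
  \<comment> \<open>The value \<open>p i\<close> is bad if adding \<open>i\<close> to some initial
    part of a flag destroys \<open>R\<close>. As \<open>i\<close> is not in \<open>\<sigma>\<close>,
    the chain of \<open>\<sigma>\<close> does not depend on \<open>p i\<close>, so the bad values
    lie in a finite union of exceptional sets.\<close>
  define bad where "bad p i \<longleftrightarrow> (\<exists>\<sigma>. distinct \<sigma> \<and> set \<sigma> \<subseteq> {..n} - {i} \<and> \<sigma> \<noteq> [] \<and>
      R (flag_points n p \<sigma>) \<and> \<not> R (flag_points n p (\<sigma> @ [i])))" for p i
  have "finite {x \<in> A i. bad (q(i := x)) i}" if i: "i \<le> n" and q: "q \<in> PiE {..n} A" for i q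
  proof -
    define D where "D = {\<sigma>. distinct \<sigma> \<and> set \<sigma> \<subseteq> {..n} - {i} \<and> \<sigma> \<noteq> [] \<and> R (flag_points n q \<sigma>)}"
    have "finite D"
      unfolding D_def by (rule finite_subset[OF _ finite_subset_distinct[of "{..n} - {i}"]]) auto
    have "finite {x \<in> A i. \<not> R (flag_points n q \<sigma> @ [(flag_point n q (set \<sigma>))(i := Some x)])}"
      if \<sigma>: "\<sigma> \<in> D" for \<sigma>
    proof (rule finite_exceptional_coordinate)
      show "flag_point n q (set \<sigma>) \<in> topspace ?X"
        using \<sigma> q by (intro flag_point_in_topspace) (auto simp: D_def)
      show "flag_point n q (set \<sigma>) i = None"
        using \<sigma> i by (auto simp: D_def flag_point_def)
      have "card (set \<sigma>) \<le> card ({..n} - {i})"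
        using \<sigma> by (intro card_mono) (auto simp: D_def)
      then have "length (flag_points n q \<sigma>) \<le> n"
        using \<sigma> i by (simp add: D_def distinct_card)
      moreover have "flag_points n q \<sigma> \<noteq> []"
        using \<sigma> length_flag_points[of n q \<sigma>] by (auto simp: D_def simp del: length_flag_points)
      ultimately show "eventually (\<lambda>y. R (flag_points n q \<sigma> @ [y])) (nhdsin ?X (flag_point n q (set \<sigma>)))"
        using \<sigma> R_step[of "flag_points n q \<sigma>"] last_flag_points[of \<sigma> n q] by (simp add: D_def)
    qed (use i in simp)
    then have "finite (\<Union>\<sigma>\<in>D. {x \<in> A i. \<not> R (flag_points n q \<sigma> @ [(flag_point n q (set \<sigma>))(i := Some x)])})"
      using \<open>finite D\<close> by blast
    moreover have "{x \<in> A i. bad (q(i := x)) i} \<subseteq>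
        (\<Union>\<sigma>\<in>D. {x \<in> A i. \<not> R (flag_points n q \<sigma> @ [(flag_point n q (set \<sigma>))(i := Some x)])})"
    proof clarify
      fix x assume x: "x \<in> A i" "bad (q(i := x)) i"
      then obtain \<sigma> where \<sigma>: "distinct \<sigma>" "set \<sigma> \<subseteq> {..n} - {i}" "\<sigma> \<noteq> []"
          "R (flag_points n (q(i := x)) \<sigma>)" "\<not> R (flag_points n (q(i := x)) (\<sigma> @ [i]))"
        unfolding bad_def by blast
      have eq: "flag_points n (q(i := x)) \<sigma> = flag_points n q \<sigma>"
        using \<sigma>(2) by (intro flag_points_cong) auto
      have "flag_point n (q(i := x)) (insert i (set \<sigma>)) = (flag_point n q (set \<sigma>))(i := Some x)"
        using \<sigma>(2) i by (intro flag_point_upd_insert) auto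
      then have "\<not> R (flag_points n q \<sigma> @ [(flag_point n q (set \<sigma>))(i := Some x)])"
        using \<sigma>(5) by (simp only: flag_points_snoc eq not_False_eq_True)
      moreover have "\<sigma> \<in> D" using \<sigma> by (simp add: D_def eq)
      ultimately show "x \<in> (\<Union>\<sigma>\<in>D. {x \<in> A i. \<not> R (flag_points n q \<sigma> @ [(flag_point n q (set \<sigma>))(i := Some x)])})"
        using x(1) by blast
    qed
    ultimately show ?thesis by (rule rev_finite_subset)
  qed
  then have "\<exists>a b. (\<forall>i<Suc n. a i \<in> E i \<and> b i \<in> F i) \<and>
      (\<forall>p \<in> PiE {..<Suc n} (\<lambda>i. {a i, b i}). \<forall>i<Suc n. \<not> bad p i)"
    using assms(1-6) by (intro ex_generic_pairs[where A = A]) (simp_all add: lessThan_Suc_atMost less_Suc_eq_le)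
  then obtain a b where ab: "\<And>i. i \<le> n \<Longrightarrow> a i \<in> E i \<and> b i \<in> F i"
    and good: "\<And>p i. p \<in> PiE {..n} (\<lambda>i. {a i, b i}) \<Longrightarrow> i \<le> n \<Longrightarrow> \<not> bad p i"
    unfolding lessThan_Suc_atMost less_Suc_eq_le by blast
  have "P (flag_points n p \<sigma>)"
    if p: "p \<in> PiE {..n} (\<lambda>i. {a i, b i})" and \<sigma>: "distinct \<sigma>" "set \<sigma> = {..n}" for p \<sigma>
  proof -
    have pA: "p i \<in> A i" if "i \<le> n" for i
      using PiE_mem[OF p, of i] ab[OF that] sub[OF that] that by auto
    \<comment> \<open>Since no added coordinate is bad, \<open>R\<close> propagates from the first
      point to the whole chain; at length \<open>Suc n\<close> nothing is left to add and
      \<open>R\<close> reduces to \<open>P\<close>.\<close>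
    have "distinct \<tau> \<Longrightarrow> set \<tau> \<subseteq> {..n} \<Longrightarrow> \<tau> \<noteq> [] \<Longrightarrow> R (flag_points n p \<tau>)" for \<tau>
    proof (induction \<tau> rule: rev_induct)
      case (snoc i \<tau>)
      show ?case
      proof (cases "\<tau> = []")
        case True
        have "flag_point n p {i} \<in> topspace ?X"
          using snoc.prems pA by (intro flag_point_in_topspace) auto
        moreover have "flag_points n p (\<tau> @ [i]) = [flag_point n p {i}]"
          by (simp add: True flag_points_def)
        ultimately show ?thesis using P by (simp add: R_def)
      next
        case False
        then have "R (flag_points n p \<tau>)" using snoc by simp
        moreover have "\<not> bad p i" using good[OF p] snoc.prems by simp
        ultimately show ?thesis using False snoc.prems unfolding bad_def by auto
      qed
    qed simp
    moreover have "\<sigma> \<noteq> []" using \<sigma>(2) by auto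
    moreover have len: "length \<sigma> = Suc n" using \<sigma> distinct_card[of \<sigma>] by simp
    ultimately have "R (flag_points n p \<sigma>)" using \<sigma> by simp
    moreover have "flag_points n p \<sigma> \<noteq> []"
      using len length_flag_points[of n p \<sigma>] by (auto simp del: length_flag_points)
    ultimately show ?thesis by (simp add: R_def len)
  qed
  then show ?thesis using ab by blast
qed

subsection \<open>Summation over flags\<close>

text \<open>In characteristic two the terms at \<open>x\<close> and \<open>t x\<close> cancel.
  Exactly one member of each pair satisfies \<open>Q\<close>, which rules out fixed points and
  splits the sum into two equal halves.\<close>

lemma sum_involution_bit:
  fixes h :: "'a \<Rightarrow> bit"
  assumes "finite S" and t: "\<And>x. x \<in> S \<Longrightarrow> t x \<in> S" "\<And>x. x \<in> S \<Longrightarrow> t (t x) = x"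
    and h: "\<And>x. x \<in> S \<Longrightarrow> h (t x) = h x" and Q: "\<And>x. x \<in> S \<Longrightarrow> Q (t x) \<longleftrightarrow> \<not> Q x"
  shows "sum h S = 0"
proof -
  have "sum h {x \<in> S. Q x} = sum h {x \<in> S. \<not> Q x}"
    by (rule sum.reindex_bij_witness[where i = t and j = t]) (use t h Q in auto)
  moreover have "sum h S = sum h {x \<in> S. Q x} + sum h {x \<in> S. \<not> Q x}"
    using assms(1) by (subst sum.union_disjoint[symmetric]) (auto intro: sum.cong)
  ultimately show ?thesis by simp
qed

definition flags :: "nat \<Rightarrow> nat list set" where
  "flags n = {\<sigma>. distinct \<sigma> \<and> set \<sigma> = {..n}}"

lemma finite_flags: "finite (flags n)"
  unfolding flags_def by (rule finite_subset[OF _ finite_subset_distinct[of "{..n}"]]) auto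

lemma length_flag: "\<sigma> \<in> flags n \<Longrightarrow> length \<sigma> = Suc n"
  using distinct_card[of \<sigma>] by (simp add: flags_def)

definition omit :: "nat \<Rightarrow> 'a list \<Rightarrow> 'a list" where
  "omit k xs = take k xs @ drop (Suc k) xs"

lemma differential_eq_sum_omit: "differential g xs = (\<Sum>k<length xs. g (omit k xs))"
  by (simp add: differential_def omit_def)

lemma omit_cong:
  assumes "length xs = length ys" "\<And>j. j < length xs \<Longrightarrow> j \<noteq> k \<Longrightarrow> xs ! j = ys ! j"
  shows "omit k xs = omit k ys"
proof -
  have "take k xs = take k ys" "drop (Suc k) xs = drop (Suc k) ys"
    using assms by (auto intro!: nth_equalityI)
  then show ?thesis by (simp add: omit_def)
qed

definition swap_adjacent :: "nat \<Rightarrow> 'a list \<Rightarrow> 'a list" where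
  "swap_adjacent k xs = xs[k := xs ! Suc k, Suc k := xs ! k]"

text \<open>Initial segments that stop before position \<open>k\<close> contain neither swapped
  entry, and those that reach past it contain both; only the point with number \<open>k\<close>
  notices the swap.\<close>

lemma omit_flag_points_swap_adjacent:
  assumes k: "Suc k < length \<sigma>"
  shows "omit k (flag_points n p (swap_adjacent k \<sigma>)) = omit k (flag_points n p \<sigma>)"
proof (rule omit_cong)
  fix j assume "j < length (flag_points n p (swap_adjacent k \<sigma>))" and jk: "j \<noteq> k"
  then have j: "j < length \<sigma>" by (simp add: swap_adjacent_def)
  have "set (take (Suc j) (swap_adjacent k \<sigma>)) = set (take (Suc j) \<sigma>)"
  proof (cases "j < k")
    case True
    then show ?thesis by (simp add: swap_adjacent_def)
  next
    case False
    then have kj: "Suc k < Suc j" using jk by simp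
    have "take (Suc j) (swap_adjacent k \<sigma>) =
        (take (Suc j) \<sigma>)[k := take (Suc j) \<sigma> ! Suc k, Suc k := take (Suc j) \<sigma> ! k]"
      using kj by (simp add: swap_adjacent_def take_update_swap)
    moreover have "k < length (take (Suc j) \<sigma>)" "Suc k < length (take (Suc j) \<sigma>)"
      using kj j by simp_all
    ultimately show ?thesis by (simp only: set_swap)
  qed
  then show "flag_points n p (swap_adjacent k \<sigma>) ! j = flag_points n p \<sigma> ! j"
    using j by (simp add: nth_flag_points swap_adjacent_def)
qed (simp add: swap_adjacent_def)

text \<open>Flags are paired by swapping the entries at \<open>k\<close> and \<open>Suc k\<close>,
  which leaves this face unchanged; whether the two entries ascend distinguishes the
  partners.\<close>

lemma sum_flags_omit_interior:
  fixes g :: "(nat \<Rightarrow> 'a option) list \<Rightarrow> bit"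
  assumes "k < n"
  shows "(\<Sum>\<sigma>\<in>flags n. g (omit k (flag_points n p \<sigma>))) = 0"
proof (rule sum_involution_bit[where t = "swap_adjacent k" and Q = "\<lambda>\<sigma>. \<sigma> ! k < \<sigma> ! Suc k"])
  fix \<sigma> assume \<sigma>: "\<sigma> \<in> flags n"
  have len: "k < length \<sigma>" "Suc k < length \<sigma>" using length_flag[OF \<sigma>] assms by auto
  show "swap_adjacent k \<sigma> \<in> flags n"
    using \<sigma> len by (simp add: flags_def swap_adjacent_def)
  show "swap_adjacent k (swap_adjacent k \<sigma>) = \<sigma>"
    using len by (intro nth_equalityI) (auto simp: swap_adjacent_def nth_list_update)
  show "g (omit k (flag_points n p (swap_adjacent k \<sigma>))) = g (omit k (flag_points n p \<sigma>))"
    using len by (simp add: omit_flag_points_swap_adjacent)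
  have "\<sigma> ! k \<noteq> \<sigma> ! Suc k"
    using \<sigma> len by (simp add: flags_def nth_eq_iff_index_eq)
  then show "(swap_adjacent k \<sigma> ! k < swap_adjacent k \<sigma> ! Suc k) \<longleftrightarrow> \<not> \<sigma> ! k < \<sigma> ! Suc k"
    using len by (auto simp: swap_adjacent_def nth_list_update)
qed (rule finite_flags)

text \<open>A flag has \<open>n + 1\<close> entries, so this face lacks the point of the full set
  and does not see the coordinate \<open>i\<close> added last. Exchanging \<open>a i\<close> and
  \<open>b i\<close> there pairs off the vertices of the cube.\<close>

lemma sum_cube_omit_last:
  fixes g :: "(nat \<Rightarrow> 'a option) list \<Rightarrow> bit"
  assumes \<sigma>: "\<sigma> \<in> flags n" and ab: "\<And>i. i \<le> n \<Longrightarrow> a i \<noteq> b i"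
  shows "(\<Sum>p \<in> PiE {..n} (\<lambda>i. {a i, b i}). g (omit n (flag_points n p \<sigma>))) = 0"
proof -
  obtain \<tau> i where \<tau>: "\<sigma> = \<tau> @ [i]"
    using length_flag[OF \<sigma>] by (cases \<sigma> rule: rev_cases) auto
  have i: "i \<le> n" "i \<notin> set \<tau>" and len: "length \<tau> = n"
    using \<sigma> length_flag[OF \<sigma>] by (auto simp: \<tau> flags_def)
  have omit: "omit n (flag_points n p \<sigma>) = flag_points n p \<tau>" for p :: "nat \<Rightarrow> 'a"
    by (simp add: \<tau> flag_points_snoc omit_def len)
  show ?thesis
    unfolding omit
  proof (rule sum_involution_bit[where t = "\<lambda>p. p(i := if p i = a i then b i else a i)"
        and Q = "\<lambda>p. p i = a i"])
    fix p assume p: "p \<in> PiE {..n} (\<lambda>i. {a i, b i})"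
    have pi: "p i = a i \<or> p i = b i" using PiE_mem[OF p, of i] i by simp
    show "p(i := if p i = a i then b i else a i) \<in> PiE {..n} (\<lambda>i. {a i, b i})"
      using p i by (auto simp: PiE_iff extensional_def)
    show "(p(i := if p i = a i then b i else a i))
        (i := if (p(i := if p i = a i then b i else a i)) i = a i then b i else a i) = p"
      using pi ab[OF i(1)] by auto
    have "flag_points n (p(i := if p i = a i then b i else a i)) \<tau> = flag_points n p \<tau>"
      using i by (intro flag_points_cong) auto
    then show "g (flag_points n (p(i := if p i = a i then b i else a i)) \<tau>) = g (flag_points n p \<tau>)"
      by (rule arg_cong)
    show "((p(i := if p i = a i then b i else a i)) i = a i) \<longleftrightarrow> \<not> p i = a i"
      using ab[OF i(1)] by simp
  qed (auto intro: finite_PiE)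
qed

lemma sum_cube_flags_differential:
  fixes g :: "(nat \<Rightarrow> 'a option) list \<Rightarrow> bit"
  assumes "\<And>i. i \<le> n \<Longrightarrow> a i \<noteq> b i"
  shows "(\<Sum>p \<in> PiE {..n} (\<lambda>i. {a i, b i}). \<Sum>\<sigma>\<in>flags n. differential g (flag_points n p \<sigma>)) = 0"
proof -
  have "(\<Sum>\<sigma>\<in>flags n. differential g (flag_points n p \<sigma>)) =
      (\<Sum>\<sigma>\<in>flags n. g (omit n (flag_points n p \<sigma>)))" for p
  proof -
    have "(\<Sum>\<sigma>\<in>flags n. differential g (flag_points n p \<sigma>)) =
        (\<Sum>\<sigma>\<in>flags n. \<Sum>k<Suc n. g (omit k (flag_points n p \<sigma>)))"
      by (intro sum.cong) (simp_all add: differential_eq_sum_omit length_flag)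
    also have "\<dots> = (\<Sum>k<Suc n. \<Sum>\<sigma>\<in>flags n. g (omit k (flag_points n p \<sigma>)))"
      by (rule sum.swap)
    also have "\<dots> = (\<Sum>\<sigma>\<in>flags n. g (omit n (flag_points n p \<sigma>)))"
      by (simp add: sum_flags_omit_interior)
    finally show ?thesis .
  qed
  then have "(\<Sum>p \<in> PiE {..n} (\<lambda>i. {a i, b i}). \<Sum>\<sigma>\<in>flags n. differential g (flag_points n p \<sigma>)) =
      (\<Sum>p \<in> PiE {..n} (\<lambda>i. {a i, b i}). \<Sum>\<sigma>\<in>flags n. g (omit n (flag_points n p \<sigma>)))"
    by simp
  also have "\<dots> = (\<Sum>\<sigma>\<in>flags n. \<Sum>p \<in> PiE {..n} (\<lambda>i. {a i, b i}). g (omit n (flag_points n p \<sigma>)))"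
    by (rule sum.swap)
  also have "\<dots> = 0"
    using assms by (intro sum.neutral ballI sum_cube_omit_last)
  finally show ?thesis .
qed

section \<open>The Cech cocycle on chains of flags\<close>

text \<open>For a flag these minima are the indices that \<open>cech_to_godement\<close> chooses
  along its chain. A new entry either leaves the minimum unchanged, causing a repetition, or becomes
  the new minimum; so repetitions are absent iff every entry undercuts all earlier ones.\<close>

lemma running_Min_distinct:
  fixes \<sigma> :: "nat list"
  defines "mins \<equiv> \<lambda>\<sigma>. map (\<lambda>k. Min (set (take (Suc k) \<sigma>))) [0..<length \<sigma>]"
  shows "distinct (mins \<sigma>) \<longleftrightarrow> sorted_wrt (>) \<sigma>" "distinct (mins \<sigma>) \<Longrightarrow> mins \<sigma> = \<sigma>"
proof -
  have mins_snoc: "mins (\<sigma> @ [i]) = mins \<sigma> @ [Min (insert i (set \<sigma>))]" for \<sigma> i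
    by (simp add: mins_def)
  have mins_eq: "distinct (mins \<sigma>) \<Longrightarrow> mins \<sigma> = \<sigma> \<and> sorted_wrt (>) \<sigma>" for \<sigma>
  proof (induction \<sigma> rule: rev_induct)
    case Nil
    then show ?case by (simp add: mins_def)
  next
    case (snoc i \<sigma>)
    then have IH: "mins \<sigma> = \<sigma>" "sorted_wrt (>) \<sigma>" by (simp_all add: mins_snoc)
    then have "Min (insert i (set \<sigma>)) \<notin> set \<sigma>"
      using snoc.prems by (simp add: mins_snoc)
    moreover have "Min (insert i (set \<sigma>)) \<in> insert i (set \<sigma>)" by (rule Min_in) auto
    ultimately have i: "Min (insert i (set \<sigma>)) = i" "i \<notin> set \<sigma>" by auto
    have "i < j" if "j \<in> set \<sigma>" for j
      using Min_le[of "insert i (set \<sigma>)" j] i that by (metis List.finite_set finite_insert insertCI le_neq_implies_less)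
    then show ?case using IH i by (simp add: mins_snoc sorted_wrt_append)
  qed
  have mins_sorted: "sorted_wrt (>) \<sigma> \<Longrightarrow> mins \<sigma> = \<sigma>" for \<sigma>
  proof (induction \<sigma> rule: rev_induct)
    case Nil
    then show ?case by (simp add: mins_def)
  next
    case (snoc i \<sigma>)
    then have "Min (insert i (set \<sigma>)) = i"
      by (intro Min_eqI) (auto simp: sorted_wrt_append)
    then show ?case using snoc by (simp add: mins_snoc sorted_wrt_append)
  qed
  have "distinct \<sigma>" if "sorted_wrt (>) \<sigma>" for \<sigma> :: "nat list"
    using that by (induction \<sigma>) auto
  then show "distinct (mins \<sigma>) \<longleftrightarrow> sorted_wrt (>) \<sigma>"
    using mins_eq mins_sorted by metis
  show "distinct (mins \<sigma>) \<Longrightarrow> mins \<sigma> = \<sigma>" using mins_eq by blast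
qed

lemma sorted_flag_iff:
  assumes "\<sigma> \<in> flags n"
  shows "sorted_wrt (>) \<sigma> \<longleftrightarrow> \<sigma> = rev [0..<Suc n]"
proof
  assume "sorted_wrt (>) \<sigma>"
  then have "sorted (rev \<sigma>)"
    by (simp add: sorted_wrt_rev) (rule sorted_wrt_mono_rel[of _ "(>)"]; simp)
  moreover have "distinct (rev \<sigma>)" "set (rev \<sigma>) = set [0..<Suc n]"
    using assms by (auto simp: flags_def simp del: upt_Suc)
  ultimately have "rev \<sigma> = [0..<Suc n]"
    by (intro sorted_distinct_set_unique) (auto simp del: upt_Suc)
  then show "\<sigma> = rev [0..<Suc n]" by (metis rev_rev_ident)
next
  assume "\<sigma> = rev [0..<Suc n]"
  moreover have "sorted_wrt (<) [0..<Suc n]" by (rule sorted_wrt_upt)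
  ultimately show "sorted_wrt (>) \<sigma>" by (simp add: sorted_wrt_rev del: upt_Suc)
qed

text \<open>The index choice made inside \<open>cech_to_godement\<close>; on the punctured space it
  is the least finite coordinate.\<close>

definition cech_index :: "(nat \<Rightarrow> 'a set) \<Rightarrow> nat \<Rightarrow> (nat \<Rightarrow> 'a option) \<Rightarrow> nat" where
  "cech_index A n x = (LEAST i. i \<in> {..n} \<and> x \<in> finite_coordinate A n i)"

lemma cech_to_godement_e_cocycle:
  "cech_to_godement {..n} (finite_coordinate A n) (e_cocycle E n) xs =
     (if distinct (map (cech_index A n) xs)
      then e_cocycle E n (set (map (cech_index A n) xs)) (last xs) else 0)"
proof -
  have "cech_index A n = (\<lambda>x. LEAST i. i \<in> {..n} \<and> x \<in> finite_coordinate A n i)"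
    by (rule ext) (rule cech_index_def)
  then show ?thesis by (simp only: cech_to_godement_def Let_def)
qed

lemma cech_index:
  assumes x: "x \<in> topspace (punctured_space A n)"
  shows cech_index_le: "cech_index A n x \<le> n"
    and cech_index_finite: "x (cech_index A n x) \<noteq> None"
    and cech_index_least: "\<And>j. j \<le> n \<Longrightarrow> x j \<noteq> None \<Longrightarrow> cech_index A n x \<le> j"
proof -
  have iff: "i \<in> {..n} \<and> x \<in> finite_coordinate A n i \<longleftrightarrow> i \<le> n \<and> x i \<noteq> None" for i
    using x by (simp add: finite_coordinate_def)
  obtain i where "i \<le> n \<and> x i \<noteq> None"
    using x unfolding in_topspace_punctured_space_iff by blast
  then have "cech_index A n x \<le> n \<and> x (cech_index A n x) \<noteq> None"
    unfolding cech_index_def iff by (rule LeastI)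
  then show "cech_index A n x \<le> n" "x (cech_index A n x) \<noteq> None" by blast+
  show "\<And>j. j \<le> n \<Longrightarrow> x j \<noteq> None \<Longrightarrow> cech_index A n x \<le> j"
    unfolding cech_index_def iff by (rule Least_le) simp
qed

text \<open>The index of a flag point is the minimum of its set of finite coordinates. A repeated
  index gives zero, so only the decreasing flag survives; there every index occurs, and the section
  is evaluated at the last point, whose coordinates are all given by \<open>p\<close>.\<close>

lemma cech_to_godement_flag_points:
  assumes \<sigma>: "\<sigma> \<in> flags n" and p: "\<And>i. i \<le> n \<Longrightarrow> p i \<in> A i"
  shows "cech_to_godement {..n} (finite_coordinate A n) (e_cocycle E n) (flag_points n p \<sigma>) =
    (if \<sigma> = rev [0..<Suc n] \<and> (\<forall>i\<le>n. p i \<in> E i) then 1 else 0)"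
proof -
  let ?l = "cech_index A n"
  have l: "?l (flag_point n p I) = Min I" if I: "I \<subseteq> {..n}" "I \<noteq> {}" for I
  proof -
    have fin: "finite I" using I finite_subset by blast
    have top: "flag_point n p I \<in> topspace (punctured_space A n)"
      using I p by (intro flag_point_in_topspace) auto
    have "?l (flag_point n p I) \<in> I"
      using cech_index_le[OF top] cech_index_finite[OF top]
      by (auto simp: flag_point_def split: if_splits)
    moreover have "?l (flag_point n p I) \<le> i" if "i \<in> I" for i
      using cech_index_least[OF top, of i] that I by (auto simp: flag_point_def)
    ultimately show ?thesis using fin by (intro Min_eqI[symmetric]) auto
  qed
  have len: "length \<sigma> = Suc n" and set: "set \<sigma> = {..n}"
    using length_flag[OF \<sigma>] \<sigma> by (auto simp: flags_def)
  have mins: "map ?l (flag_points n p \<sigma>) = map (\<lambda>k. Min (set (take (Suc k) \<sigma>))) [0..<length \<sigma>]"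
  proof (rule nth_equalityI)
    fix k assume k: "k < length (map ?l (flag_points n p \<sigma>))"
    have "set (take (Suc k) \<sigma>) \<subseteq> {..n}" using set_take_subset set by metis
    moreover have "set (take (Suc k) \<sigma>) \<noteq> {}" using len by (auto simp: take_Suc_conv_app_nth)
    ultimately show "map ?l (flag_points n p \<sigma>) ! k = map (\<lambda>k. Min (set (take (Suc k) \<sigma>))) [0..<length \<sigma>] ! k"
      using k l by (simp add: nth_flag_points)
  qed simp
  have last: "last (flag_points n p \<sigma>) = flag_point n p {..n}"
    using last_flag_points[of \<sigma> n p] len set by fastforce
  have val: "(\<forall>i\<le>n. flag_point n p {..n} i \<in> Some ` E i) \<longleftrightarrow> (\<forall>i\<le>n. p i \<in> E i)"
    by (auto simp: flag_point_def)
  have "cech_to_godement {..n} (finite_coordinate A n) (e_cocycle E n) (flag_points n p \<sigma>) =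
    (if distinct (map ?l (flag_points n p \<sigma>)) then
       e_cocycle E n (set (map ?l (flag_points n p \<sigma>))) (last (flag_points n p \<sigma>)) else 0)"
    by (rule cech_to_godement_e_cocycle)
  also have "\<dots> = (if sorted_wrt (>) \<sigma> then e_cocycle E n {..n} (flag_point n p {..n}) else 0)"
    using running_Min_distinct[of \<sigma>] set unfolding mins last by (metis (no_types, lifting))
  also have "\<dots> = (if \<sigma> = rev [0..<Suc n] \<and> (\<forall>i\<le>n. p i \<in> E i) then 1 else 0)"
    unfolding sorted_flag_iff[OF \<sigma>] e_cocycle_def val by simp
  finally show ?thesis .
qed

section \<open>The cocycle condition\<close>

text \<open>Meant for the Cech indices along a chain: the equal neighbours both survive in every
  face that omits another entry, so such a face contributes zero to the differential.\<close>

lemma not_distinct_omit: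
  assumes "Suc k < length xs" "xs ! k = xs ! Suc k" "i < length xs" "i \<noteq> k" "i \<noteq> Suc k"
  shows "\<not> distinct (omit i xs)"
proof (cases "i < k")
  case True
  have "\<not> distinct (drop (Suc i) xs)"
  proof
    assume "distinct (drop (Suc i) xs)"
    then have "drop (Suc i) xs ! (k - Suc i) \<noteq> drop (Suc i) xs ! (k - i)"
      using True assms(1) by (subst nth_eq_iff_index_eq) auto
    then show False using True assms(1,2) by simp
  qed
  then show ?thesis by (simp add: omit_def)
next
  case False
  have "\<not> distinct (take i xs)"
  proof
    assume "distinct (take i xs)"
    then have "take i xs ! k \<noteq> take i xs ! Suc k"
      using False assms by (subst nth_eq_iff_index_eq) auto
    then show False using False assms by simp
  qed
  then show ?thesis by (simp add: omit_def)
qed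

lemma omit_Suc_eq:
  assumes "Suc k < length xs" "xs ! k = xs ! Suc k"
  shows "omit (Suc k) xs = omit k xs"
  using assms by (simp add: omit_def take_Suc_conv_app_nth Cons_nth_drop_Suc[symmetric])

lemma map_omit: "map f (omit k xs) = omit k (map f xs)"
  by (simp add: omit_def take_map drop_map)

text \<open>
  Along a chain of successively near points the set of finite coordinates grows, so the chosen
  indices decrease weakly; by pigeonhole two neighbours among \<open>n + 2\<close> of them coincide.
\<close>

lemma differential_cech_to_godement_chain:
  assumes top: "set xs \<subseteq> topspace (punctured_space A n)" and len: "length xs = Suc (Suc n)"
    and chain: "successively (\<lambda>x y. \<forall>i\<le>n. x i \<noteq> None \<longrightarrow> y i = x i) xs"
  shows "differential (cech_to_godement {..n} (finite_coordinate A n) (e_cocycle E n)) xs = 0"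
proof -
  define c where "c = cech_to_godement {..n} (finite_coordinate A n) (e_cocycle E n)"
  let ?l = "cech_index A n"
  define L where "L = map ?l xs"
  have c: "c ys = (if distinct (map ?l ys) then e_cocycle E n (set (map ?l ys)) (last ys) else 0)" for ys
    unfolding c_def by (rule cech_to_godement_e_cocycle)
  have top_nth: "xs ! k \<in> topspace (punctured_space A n)" if "k \<le> Suc n" for k
    using nth_mem[of k xs] top len that by auto
  have agree: "(xs ! Suc k) i = (xs ! k) i" if "k \<le> n" "i \<le> n" "(xs ! k) i \<noteq> None" for k i
    using chain that len by (simp add: successively_conv_nth)
  have l_le: "?l (xs ! k) \<le> n" and l_fin: "(xs ! k) (?l (xs ! k)) \<noteq> None" if "k \<le> Suc n" for k
    using cech_index_le cech_index_finite top_nth[OF that] by blast+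
  have l_step: "?l (xs ! Suc k) \<le> ?l (xs ! k)" if "k \<le> n" for k
    using cech_index_least[of "xs ! Suc k" A n "?l (xs ! k)"] top_nth[of "Suc k"]
      agree[OF that l_le l_fin] l_le[of k] l_fin[of k] that by simp
  obtain k where k: "k \<le> n" "?l (xs ! Suc k) = ?l (xs ! k)"
  proof -
    have "\<exists>k\<le>n. ?l (xs ! Suc k) = ?l (xs ! k)"
    proof (rule ccontr)
      assume "\<not> ?thesis"
      then have less: "?l (xs ! Suc k) < ?l (xs ! k)" if "k \<le> n" for k
        using l_step[OF that] that le_neq_implies_less by blast
      have "?l (xs ! k) + k \<le> n" if "k \<le> Suc n" for k
        using that
      proof (induction k)
        case 0
        then show ?case using l_le[of 0] by simp
      next
        case (Suc k)
        then show ?case using less[of k] by simp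
      qed
      from this[of "Suc n"] show False by simp
    qed
    then show ?thesis using that by blast
  qed
  have Lk: "Suc k < length L" "L ! k = L ! Suc k" using k len by (simp_all add: L_def)
  have zero: "c (omit i xs) = 0" if "i < Suc (Suc n)" "i \<noteq> k" "i \<noteq> Suc k" for i
    using not_distinct_omit[OF Lk, of i] that len by (simp add: c map_omit L_def)
  \<comment> \<open>Both faces have the same list of indices, so only the points at which the
    section is evaluated can differ.\<close>
  have pair: "c (omit (Suc k) xs) = c (omit k xs)"
  proof -
    have maps: "map ?l (omit (Suc k) xs) = map ?l (omit k xs)"
      unfolding map_omit using omit_Suc_eq[OF Lk] by (simp add: L_def)
    have "e_cocycle E n (set (map ?l (omit k xs))) (last (omit (Suc k) xs)) =
        e_cocycle E n (set (map ?l (omit k xs))) (last (omit k xs))"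
      if dist: "distinct (map ?l (omit k xs))"
    proof (cases "k = n")
      case False
      then have "last (omit (Suc k) xs) = last xs" "last (omit k xs) = last xs"
        using k len by (simp_all add: omit_def last_append)
      then show ?thesis by simp
    next
      case True
      \<comment> \<open>Here the faces end in \<open>xs ! n\<close> and \<open>xs ! Suc n\<close>.
        The \<open>n + 1\<close> distinct indices exhaust \<open>{..n}\<close>, so every coordinate
        is already finite at \<open>xs ! n\<close> and stays the same at the next point.\<close>
      have maps_take: "map ?l (omit k xs) = map ?l (take (Suc n) xs)"
        using maps len True by (simp add: omit_def)
      have "set (map ?l (take (Suc n) xs)) \<subseteq> {..n}"
        using l_le len by (auto simp: in_set_conv_nth)
      moreover have "card (set (map ?l (take (Suc n) xs))) = Suc n"
        using distinct_card[OF dist] maps_take len by simp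
      ultimately have all: "set (map ?l (take (Suc n) xs)) = {..n}"
        by (intro card_subset_eq) auto
      have persist: "(xs ! b) i \<noteq> None" if "a \<le> b" "b \<le> n" "i \<le> n" "(xs ! a) i \<noteq> None" for a b i
        using that
      proof (induction b rule: dec_induct)
        case (step b)
        then show ?case using agree[of b i] by simp
      qed
      have "(xs ! Suc n) i = (xs ! n) i" if i: "i \<le> n" for i
      proof -
        have "i \<in> set (map ?l (take (Suc n) xs))" using all i by simp
        then obtain x where "x \<in> set (take (Suc n) xs)" and x: "?l x = i"
          unfolding set_map by blast
        then obtain a where "a < Suc n" "xs ! a = x"
          using len unfolding in_set_conv_nth by auto
        then have a: "a \<le> n" "?l (xs ! a) = i" using x by simp_all
        then have "(xs ! a) i \<noteq> None" using l_fin[of a] by auto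
        then have "(xs ! n) i \<noteq> None" using persist[of a n i] a i by simp
        then show ?thesis using agree[of n i] i by simp
      qed
      moreover have "xs \<noteq> []" using len by auto
      then have "last (omit (Suc k) xs) = xs ! n" "last (omit k xs) = xs ! Suc n"
        using len True Cons_nth_drop_Suc[of "Suc n" xs] last_conv_nth[of xs]
        by (auto simp: omit_def take_Suc_conv_app_nth)
      ultimately show ?thesis by (simp add: e_cocycle_def)
    qed
    then show ?thesis unfolding c maps by simp
  qed
  have "(\<Sum>i<length xs. c (omit i xs)) = (\<Sum>i\<in>{k, Suc k}. c (omit i xs))"
    using zero k len by (intro sum.mono_neutral_right) auto
  also have "\<dots> = 0" using pair by simp
  finally show ?thesis unfolding differential_eq_sum_omit c_def .
qed

lemma cech_to_godement_in_cocycles: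
  "cech_to_godement {..n} (finite_coordinate A n) (e_cocycle E n) \<in> cocycles (punctured_space A n) n"
  unfolding cocycles_def null_cochains_def mem_Collect_eq
proof (intro ballI)
  fix x assume x: "x \<in> topspace (punctured_space A n)"
  show "successively_near (punctured_space A n) (Suc n) x
      (\<lambda>xs. differential (cech_to_godement {..n} (finite_coordinate A n) (e_cocycle E n)) xs = 0)"
    by (rule successively_nearI[OF eventually_same_finite_coordinates x])
      (use x in \<open>auto intro!: differential_cech_to_godement_chain\<close>)
qed

section \<open>Cohomology classes and nonvanishing\<close>

lemma zero_in_null_cochains: "(\<lambda>xs. 0) \<in> null_cochains X n"
proof -
  have "successively_near X n x (\<lambda>xs. True)" for x
    by (induction n arbitrary: x) simp_all
  then show ?thesis by (simp add: null_cochains_def)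
qed

text \<open>Puts degree zero in the form of the other degrees, with \<open>g = 0\<close> as witness.
  There the conclusion is weaker, since on one-point tuples \<open>differential g\<close> may be a
  nonzero constant, but the cube sum refutes it all the same.\<close>

lemma coboundaries_cong_differential:
  assumes "f \<in> coboundaries X n"
  shows "\<exists>g. (\<lambda>xs. f xs - differential g xs) \<in> null_cochains X n"
proof (cases "n = 0")
  case True
  show ?thesis
  proof (rule exI[of _ "\<lambda>xs. 0"])
    show "(\<lambda>xs. f xs - differential (\<lambda>xs. 0) xs) \<in> null_cochains X n"
      using assms True unfolding coboundaries_def differential_def sum.neutral_const diff_zero by simp
  qed
qed (use assms in \<open>simp add: coboundaries_def\<close>)

lemma zero_in_coboundaries: "(\<lambda>xs. 0) \<in> coboundaries X n"
proof (cases "n = 0")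
  case False
  have "(\<lambda>xs. 0 - differential (\<lambda>xs. 0) xs) \<in> null_cochains X n"
    using zero_in_null_cochains by (simp add: differential_def)
  then show ?thesis using False unfolding coboundaries_def by auto
qed (simp add: coboundaries_def zero_in_null_cochains)

text \<open>The zero function is a coboundary, so a coset contains its representative; a trivial
  class thus has a coboundary as representative.\<close>

lemma mem_cohomology_class: "f \<in> cohomology_class X n f"
proof -
  have "(\<lambda>xs. 0) \<otimes>\<^bsub>cocycle_group X n\<^esub> f = f" by (simp only: cocycle_group_def monoid.select_convs add_0_left)
  then show ?thesis
    using zero_in_coboundaries[of X n] unfolding cohomology_class_def r_coset_def by force
qed

lemma cech_to_godement_notin_coboundaries:
  fixes A E F :: "nat \<Rightarrow> 'a set"
  assumes sub: "\<And>i. i \<le> n \<Longrightarrow> E i \<subseteq> A i" "\<And>i. i \<le> n \<Longrightarrow> F i \<subseteq> A i"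
    and inf: "\<And>i. i \<le> n \<Longrightarrow> infinite (E i)" "\<And>i. i \<le> n \<Longrightarrow> infinite (F i)"
    and less: "\<And>i. i \<le> n \<Longrightarrow> |PiE {..<i} A| <o |E i|" "\<And>i. i \<le> n \<Longrightarrow> |PiE {..<i} A| <o |F i|"
    and disj: "\<And>i. i \<le> n \<Longrightarrow> E i \<inter> F i = {}"
  shows "cech_to_godement {..n} (finite_coordinate A n) (e_cocycle E n) \<notin>
    coboundaries (punctured_space A n) n"
proof
  let ?c = "cech_to_godement {..n} (finite_coordinate A n) (e_cocycle E n)"
  assume "?c \<in> coboundaries (punctured_space A n) n"
  then obtain g where "(\<lambda>xs. ?c xs - differential g xs) \<in> null_cochains (punctured_space A n) n"
    using coboundaries_cong_differential by blast
  then have "successively_near (punctured_space A n) n x (\<lambda>xs. ?c xs - differential g xs = 0)"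
    if "x \<in> topspace (punctured_space A n)" for x
    using that by (simp add: null_cochains_def)
  from ex_generic_flags[OF sub inf less this]
  obtain a b where ab: "\<And>i. i \<le> n \<Longrightarrow> a i \<in> E i" "\<And>i. i \<le> n \<Longrightarrow> b i \<in> F i"
    and eq: "\<And>p \<sigma>. p \<in> PiE {..n} (\<lambda>i. {a i, b i}) \<Longrightarrow> \<sigma> \<in> flags n \<Longrightarrow>
      ?c (flag_points n p \<sigma>) = differential g (flag_points n p \<sigma>)"
    unfolding flags_def right_minus_eq by blast
  let ?S = "PiE {..n} (\<lambda>i. {a i, b i})" and ?a = "restrict a {..n}"
  have a_ne_b: "a i \<noteq> b i" if "i \<le> n" for i using ab[OF that] disj[OF that] by auto
  \<comment> \<open>Only the decreasing flag contributes. As \<open>b i\<close> lies in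
    \<open>F i\<close>, disjoint from \<open>E i\<close>, the one vertex with all coordinates in the
    sets \<open>E i\<close> is \<open>?a\<close>, restricted because cube elements are
    extensional.\<close>
  have "(\<Sum>\<sigma>\<in>flags n. ?c (flag_points n p \<sigma>)) = (if p = ?a then 1 else 0)" if p: "p \<in> ?S" for p
  proof -
    have pi: "p i = a i \<or> p i = b i" if "i \<le> n" for i using PiE_mem[OF p, of i] that by simp
    have "p i \<in> A i" if "i \<le> n" for i using pi[OF that] ab[OF that] sub[OF that] by auto
    then have "(\<Sum>\<sigma>\<in>flags n. ?c (flag_points n p \<sigma>)) =
        (\<Sum>\<sigma>\<in>flags n. if \<sigma> = rev [0..<Suc n] then (if \<forall>i\<le>n. p i \<in> E i then 1 else 0) else 0)"
      by (intro sum.cong) (simp_all add: cech_to_godement_flag_points del: upt_Suc)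
    also have "\<dots> = (if \<forall>i\<le>n. p i \<in> E i then 1 else 0)"
      using finite_flags[of n] by (subst sum.delta) (auto simp: flags_def)
    also have "(\<forall>i\<le>n. p i \<in> E i) \<longleftrightarrow> p = ?a"
    proof
      assume E: "\<forall>i\<le>n. p i \<in> E i"
      show "p = ?a"
      proof (rule extensionalityI[of _ "{..n}"])
        fix i assume "i \<in> {..n}"
        then show "p i = ?a i" using E pi[of i] ab(2)[of i] disj[of i] by auto
      qed (use p in \<open>auto simp: PiE_iff\<close>)
    qed (use ab in auto)
    finally show ?thesis .
  qed
  then have "(\<Sum>p\<in>?S. \<Sum>\<sigma>\<in>flags n. ?c (flag_points n p \<sigma>)) = (\<Sum>p\<in>?S. if p = ?a then 1 else 0)"
    by (intro sum.cong) simp_all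
  also have "\<dots> = 1"
    by (subst sum.delta) (auto intro: finite_PiE)
  finally have "(\<Sum>p\<in>?S. \<Sum>\<sigma>\<in>flags n. ?c (flag_points n p \<sigma>)) = 1" .
  moreover have "(\<Sum>p\<in>?S. \<Sum>\<sigma>\<in>flags n. ?c (flag_points n p \<sigma>)) = 0"
    using eq sum_cube_flags_differential[of n a b g] a_ne_b by simp
  ultimately show False by simp
qed

theorem theorem2p8:
  fixes n :: nat
    and \<alpha> :: "nat \<Rightarrow> 'b rel"
    and A E F :: "nat \<Rightarrow> 'a set"
  assumes ordinals: "\<And>i. i \<le> n \<Longrightarrow> Well_order (\<alpha> i)"
    and increasing: "\<And>i. i < n \<Longrightarrow> \<alpha> i <o \<alpha> (Suc i)"
    and alephs: "\<And>i. i \<le> n \<Longrightarrow> has_card_aleph (A i) (\<alpha> i)"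
    and decomposition: "\<And>i. i \<le> n \<Longrightarrow> A i = E i \<union> F i"
    and disjoint: "\<And>i. i \<le> n \<Longrightarrow> E i \<inter> F i = {}"
    and same_card: "\<And>i. i \<le> n \<Longrightarrow> |E i| =o |F i|"
  shows "epsilon_class A E n \<in> carrier (cohomology_group (punctured_space A n) n) \<and>
         epsilon_class A E n \<noteq> \<one>\<^bsub>cohomology_group (punctured_space A n) n\<^esub>"
proof
  let ?X = "punctured_space A n"
  let ?c = "cech_to_godement {..n} (finite_coordinate A n) (e_cocycle E n)"
  have "?c \<in> carrier (cocycle_group ?X n)"
    by (simp add: cocycle_group_def cech_to_godement_in_cocycles)
  then show "epsilon_class A E n \<in> carrier (cohomology_group ?X n)"
    unfolding epsilon_class_def cohomology_group_def cohomology_class_def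
    by (auto simp: FactGroup_def RCOSETS_def)
  have infA: "infinite (A i)" if "i \<le> n" for i
    using alephs[OF that] by (simp add: has_card_aleph_def)
  have infE: "infinite (E i)" and infF: "infinite (F i)" if "i \<le> n" for i
    using infA[OF that] decomposition[OF that] card_of_ordIso_finite[OF same_card[OF that]] by auto
  have lessA: "|PiE {..<i} A| <o |A i|" if "i \<le> n" for i
  proof (rule card_of_PiE_initial_less[of n A, OF infA _ that])
    show "|A j| <o |A (Suc j)|" if "j < n" for j
      using that by (intro has_card_aleph_strict_mono[OF ordinals increasing alephs alephs]) simp_all
  qed
  \<comment> \<open>Equal halves of an infinite set have its full cardinality, which carries the
    bound on the product from \<open>A i\<close> over to \<open>E i\<close> and
    \<open>F i\<close>.\<close>
  have A_E: "|A i| \<le>o |E i|" if "i \<le> n" for i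
    unfolding decomposition[OF that]
  proof (rule card_of_Un_ordLeq_infinite_Field)
    show "infinite (Field |E i| )" using infE[OF that] by (simp add: Field_card_of)
    show "|E i| \<le>o |E i|" using card_of_refl by (rule ordIso_imp_ordLeq)
    show "|F i| \<le>o |E i|" using ordIso_symmetric[OF same_card[OF that]] by (rule ordIso_imp_ordLeq)
    show "Card_order |E i|" by (rule card_of_Card_order)
  qed
  have lessE: "|PiE {..<i} A| <o |E i|" if "i \<le> n" for i
    using lessA[OF that] A_E[OF that] by (rule ordLess_ordLeq_trans)
  have lessF: "|PiE {..<i} A| <o |F i|" if "i \<le> n" for i
    using lessE[OF that] same_card[OF that] by (rule ordLess_ordIso_trans)
  have "?c \<notin> coboundaries ?X n"
    by (rule cech_to_godement_notin_coboundaries[OF _ _ infE infF lessE lessF disjoint])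
      (use decomposition in blast)+
  moreover have "?c \<in> epsilon_class A E n"
    unfolding epsilon_class_def by (rule mem_cohomology_class)
  \<comment> \<open>The identity of the quotient is the set of coboundaries, which does not contain
    \<open>?c\<close>.\<close>
  ultimately show "epsilon_class A E n \<noteq> \<one>\<^bsub>cohomology_group ?X n\<^esub>"
    by (auto simp: cohomology_group_def FactGroup_def)
qed

end
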